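(* Let $A,B\in O(d)$, let $D_\xi\in\mathbb R^{d\times d}$ be a Rademacher diagonal matrix, and let $\pi$ be an independent uniformly random permutation in $S_d$. Let $0<\eta<1/2$ and set $U=AD_\xi P_\pi B$. Suppose that $$\|A\|_\infty\|B\|_\infty\le\frac{1}{\sqrt{d\log(d/\eta)}}.$$ Then, with probability at least $1-\eta$, $$\|U\|_\infty\le 4\,\frac{\sqrt{\log(d/\eta)}}{\sqrt d}.$$
   Context: $O(d)$ is the group of real orthogonal $d\times d$ matrices and $S_d$ the permutation group of $\{1,\dots,d\}$. For a real matrix $M$, $\|M\|_\infty=\max_{i,j}|M_{ij}|$. A Rademacher diagonal matrix is $D_\xi=\operatorname{diag}(\xi_1,\dots,\xi_d)$ with $\xi$ uniform on $\{-1,1\}^d$. $P_\pi$ is the permutation matrix with $(P_\pi x)_k=x_{\pi(k)}$. *)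

theory Defs
  imports "HOL-Probability.Probability"
begin

definition max_entry :: "real ^ 'n::finite ^ 'm::finite \<Rightarrow> real" where
  "max_entry M = Max {\<bar>M $ i $ j\<bar> | i j. True}"

definition diag_matrix :: "real ^ 'n::finite \<Rightarrow> real ^ 'n ^ 'n" where
  "diag_matrix x = (\<chi> i j. if i = j then x $ i else 0)"

definition perm_matrix :: "('n::finite \<Rightarrow> 'n) \<Rightarrow> real ^ 'n ^ 'n" where
  "perm_matrix p = (\<chi> k j. if j = p k then 1 else 0)"

lemma perm_matrix_mult_vec: "(perm_matrix p *v x) $ k = x $ p k"
  by (simp add: perm_matrix_def matrix_vector_mult_def if_distribR if_distrib[of "\<lambda>t. t * _"] cong: if_cong)

definition sign_vectors :: "(real ^ 'n::finite) set" where
  "sign_vectors = {x. \<forall>i. x $ i \<in> {-1, 1}}"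

definition permutation_group :: "('n::finite \<Rightarrow> 'n) set" where
  "permutation_group = {p. p permutes UNIV}"

text \<open>A random variable on \<open>M\<close> taking values in the finite set \<open>S\<close> (with its discrete
  sigma-algebra) and uniformly distributed there.\<close>

definition uniformly_distributed :: "'a measure \<Rightarrow> ('a \<Rightarrow> 'b) \<Rightarrow> 'b set \<Rightarrow> bool" where
  "uniformly_distributed M X S \<longleftrightarrow>
     X \<in> measurable M (count_space S) \<and> distr M (count_space S) X = uniform_count_measure S"

text \<open>The library constant \<open>indep_var\<close> forces both variables to have the same value type, so
  independence of \<open>X\<close> and \<open>Y\<close> is stated as independence of the sigma-algebras they generate.\<close>

definition independent_rvs ::
  "'a measure \<Rightarrow> 'b measure \<Rightarrow> ('a \<Rightarrow> 'b) \<Rightarrow> 'c measure \<Rightarrow> ('a \<Rightarrow> 'c) \<Rightarrow> bool" where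
  "independent_rvs M S X T Y \<longleftrightarrow>
     X \<in> measurable M S \<and> Y \<in> measurable M T \<and>
     prob_space.indep_set M
       (sets (vimage_algebra (space M) X S)) (sets (vimage_algebra (space M) Y T))"

end

theory Submission
  imports Defs
begin

text \<open>Every entry of \<open>U\<close> has the form \<open>\<Sum>k. a k * \<xi> k * b (\<pi> k)\<close> with unit vectors \<open>a\<close>, \<open>b\<close>. Averaging
  over the signs bounds its moment generating function at \<open>t\<close> by the mean of
  \<open>\<Prod>k. exp (t\<^sup>2 (a k)\<^sup>2 (b (\<pi> k))\<^sup>2 / 2)\<close>, and negative association of the random permutation bounds
  this by the product of the means. For \<open>t = sqrt (d L)\<close>, where \<open>L = ln (d / \<eta>)\<close>, the hypothesis on \<open>A\<close>
  and \<open>B\<close> keeps each exponent at most \<open>1 / 2\<close>, so the product is at most \<open>exp L\<close>. Markov's inequality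
  gives the tail bound \<open>2 * exp (- 3 * L)\<close> for one entry, and a union bound over the \<open>d\<^sup>2\<close> entries
  concludes.\<close>

section \<open>Chebyshev's sum inequality and negative association of random permutations\<close>

text \<open>Summing \<open>(f k - f l) * (h k - h l)\<close> over all pairs gives twice the left
  side minus the right side, and no term is positive because \<open>f\<close> and \<open>h\<close>
  are ordered oppositely along the key \<open>y\<close>.\<close>

lemma Chebyshev_sum_upper_countermonotone:
  fixes f h :: "'b \<Rightarrow> real" and y :: "'b \<Rightarrow> 'c::linorder"
  assumes f: "\<And>k l. k \<in> A \<Longrightarrow> l \<in> A \<Longrightarrow> y k \<le> y l \<Longrightarrow> f k \<le> f l"
    and h: "\<And>k l. k \<in> A \<Longrightarrow> l \<in> A \<Longrightarrow> y k \<le> y l \<Longrightarrow> h l \<le> h k"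
  shows "real (card A) * (\<Sum>k\<in>A. f k * h k) \<le> (\<Sum>k\<in>A. f k) * (\<Sum>k\<in>A. h k)"
proof -
  let ?S = "\<Sum>k\<in>A. \<Sum>l\<in>A. (f k - f l) * (h k - h l)"
  have "?S = 2 * (real (card A) * (\<Sum>k\<in>A. f k * h k) - (\<Sum>k\<in>A. f k) * (\<Sum>l\<in>A. h l))"
    by (simp add: left_diff_distrib right_diff_distrib sum_subtractf sum_product
        sum.swap[of "\<lambda>k l. f l * h k"] flip: sum_distrib_left)
  moreover have "?S \<le> 0"
  proof (intro sum_nonpos)
    fix k l assume "k \<in> A" "l \<in> A"
    then show "(f k - f l) * (h k - h l) \<le> 0"
      using f[of k l] f[of l k] h[of k l] h[of l k]
      by (cases "y k \<le> y l") (auto simp: mult_le_0_iff)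
  qed
  ultimately show ?thesis by simp
qed

text \<open>Negative association of a uniformly random permutation. Conditioning on the value
  \<open>l = p k\<^sub>0\<close> of one more coordinate, the conditional sum \<open>H l\<close> over the other coordinates decreases
  in \<open>y l\<close>, because a large value has been used up; Chebyshev's inequality then decouples.\<close>

lemma sum_permutations_prod_le:
  fixes g :: "'n::finite \<Rightarrow> 'n \<Rightarrow> real" and y :: "'n \<Rightarrow> 'c::linorder"
  assumes nonneg: "\<And>k l. 0 \<le> g k l"
    and mono: "\<And>k l l'. y l \<le> y l' \<Longrightarrow> g k l \<le> g k l'"
  shows "(\<Sum>p | p permutes UNIV. \<Prod>k\<in>K. g k (p k))
           \<le> fact CARD('n) * (\<Prod>k\<in>K. (\<Sum>l\<in>UNIV. g k l) / real CARD('n))"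
  using finite[of K]
proof (induction K rule: finite_induct)
  case empty
  then show ?case by (simp add: card_permutations)
next
  case (insert k0 K)
  let ?P = "{p :: 'n \<Rightarrow> 'n. p permutes UNIV}"
  let ?G = "\<lambda>p. \<Prod>k\<in>K. g k (p k)"
  define H where "H l = (\<Sum>p | p permutes UNIV \<and> p k0 = l. ?G p)" for l
  have fibres: "(\<Sum>p\<in>?P. F p) = (\<Sum>l\<in>UNIV. \<Sum>p | p permutes UNIV \<and> p k0 = l. F p)"
    for F :: "('n \<Rightarrow> 'n) \<Rightarrow> real"
    using sum.group[of ?P UNIV "\<lambda>p. p k0" F] by simp
  have H_anti: "H l' \<le> H l" if le: "y l \<le> y l'" for l l'
  proof -
    \<comment> \<open>Exchanging the values \<open>l\<close> and \<open>l'\<close> maps the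
      permutations with \<open>p k0 = l\<close> bijectively onto those with
      \<open>p k0 = l'\<close>. When \<open>p k0 = l\<close>, no \<open>k\<close> in
      \<open>K\<close> has the value \<open>l\<close>, so the exchange can only turn a value
      \<open>l'\<close> into \<open>l\<close>, which does not raise any factor.\<close>
    let ?t = "Transposition.transpose l l'"
    have "H l' = (\<Sum>p | p permutes UNIV \<and> p k0 = l. ?G (?t \<circ> p))"
      unfolding H_def
    proof (rule sum.reindex_bij_witness[where i = "\<lambda>p. ?t \<circ> p" and j = "\<lambda>p. ?t \<circ> p"])
    qed (auto simp: fun_eq_iff intro!: permutes_compose permutes_swap_id)
    also have "\<dots> \<le> H l"
      unfolding H_def
    proof (intro sum_mono prod_mono conjI nonneg)
      fix p k assume p: "p \<in> {p. p permutes UNIV \<and> p k0 = l}" and k: "k \<in> K"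
      then have "inj p" and "k \<noteq> k0"
        using insert.hyps by (auto dest: permutes_inj)
      then have "p k \<noteq> l"
        using p by (auto dest: injD)
      then show "g k ((?t \<circ> p) k) \<le> g k (p k)"
        using mono[OF le] by (cases "p k = l'") auto
    qed
    finally show ?thesis .
  qed
  have "(\<Sum>p\<in>?P. \<Prod>k\<in>insert k0 K. g k (p k)) = (\<Sum>l\<in>UNIV. g k0 l * H l)"
    using insert.hyps by (simp add: fibres H_def sum_distrib_left)
  also have "\<dots> \<le> (\<Sum>l\<in>UNIV. g k0 l) * (\<Sum>l\<in>UNIV. H l) / real CARD('n)"
    using Chebyshev_sum_upper_countermonotone[of UNIV y "g k0" H] mono H_anti
    by (simp add: field_simps)
  also have "(\<Sum>l\<in>UNIV. H l) = (\<Sum>p\<in>?P. ?G p)"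
    by (simp add: fibres H_def)
  also have "(\<Sum>l\<in>UNIV. g k0 l) * (\<Sum>p\<in>?P. ?G p) / real CARD('n)
      \<le> (\<Sum>l\<in>UNIV. g k0 l) * (fact CARD('n) * (\<Prod>k\<in>K. (\<Sum>l\<in>UNIV. g k l) / real CARD('n)))
         / real CARD('n)"
    by (intro divide_right_mono mult_left_mono insert.IH sum_nonneg nonneg) simp
  also have "\<dots> = fact CARD('n) * (\<Prod>k\<in>insert k0 K. (\<Sum>l\<in>UNIV. g k l) / real CARD('n))"
    using insert.hyps by simp
  finally show ?case .
qed

section \<open>Exponential moments of Rademacher sums\<close>

text \<open>This is Hoeffding's lemma for a fair sign; evenness of cosh reduces it to nonnegative
  arguments.\<close>

lemma cosh_le_exp_half_square:
  fixes x :: real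
  shows "cosh x \<le> exp (x\<^sup>2 / 2)"
proof -
  have *: "cosh z \<le> exp (z\<^sup>2 / 2)" if "0 \<le> z" for z :: real
  proof -
    \<comment> \<open>At \<open>2 * z\<close> and \<open>1 / 2\<close> the function bounded by
      \<open>Hoeffdings_lemma_aux\<close> is \<open>ln (cosh z)\<close>, and the bound
      \<open>(2 * z)\<^sup>2 / 8\<close> is \<open>z\<^sup>2 / 2\<close>.\<close>
    have eq: "1 + 1 / 2 * (exp (2 * z) - 1) = exp z * cosh z"
      by (simp add: cosh_def field_simps flip: exp_add)
    have "- z + ln (exp z * cosh z) \<le> z\<^sup>2 / 2"
      using Hoeffdings_lemma_aux[of "2 * z" "1 / 2"] that unfolding eq by (simp add: power2_eq_square)
    then have "ln (cosh z) \<le> z\<^sup>2 / 2"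
      by (simp add: ln_mult)
    then show ?thesis
      by (simp flip: ln_le_cancel_iff)
  qed
  show ?thesis
    using *[of x] *[of "- x"] by (cases "0 \<le> x") auto
qed

lemma sum_sign_vectors_eq:
  fixes F :: "real ^ 'n::finite \<Rightarrow> real"
  shows "(\<Sum>x\<in>sign_vectors. F x) = (\<Sum>s\<in>PiE UNIV (\<lambda>_. {-1, 1}). F (\<chi> k. s k))"
  by (rule sum.reindex_bij_witness[where i = "\<lambda>s. \<chi> k. s k" and j = "\<lambda>x. ($) x"])
     (auto simp: sign_vectors_def PiE_def Pi_def)

lemma card_sign_vectors: "card (sign_vectors :: (real ^ 'n::finite) set) = 2 ^ CARD('n)"
  using sum_sign_vectors_eq[of "\<lambda>_ :: real ^ 'n. 1"] by (simp add: card_PiE)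

lemma finite_sign_vectors: "finite (sign_vectors :: (real ^ 'n::finite) set)"
  by (rule card_ge_0_finite) (simp add: card_sign_vectors)

lemma card_permutation_group: "card (permutation_group :: ('n::finite \<Rightarrow> 'n) set) = fact CARD('n)"
  by (simp add: permutation_group_def card_permutations)

text \<open>The coordinates of a sign vector vary independently, so the sum factors into one term
  \<open>2 * cosh (c k)\<close> per coordinate.\<close>

lemma sum_sign_vectors_exp_le:
  fixes c :: "'n::finite \<Rightarrow> real"
  shows "(\<Sum>x\<in>sign_vectors. exp (\<Sum>k\<in>UNIV. c k * x $ k))
           \<le> 2 ^ CARD('n) * (\<Prod>k\<in>UNIV. exp ((c k)\<^sup>2 / 2))"
proof -
  have "(\<Sum>x\<in>sign_vectors. exp (\<Sum>k\<in>UNIV. c k * x $ k))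
      = (\<Sum>s\<in>PiE UNIV (\<lambda>_. {-1, 1}). \<Prod>k\<in>UNIV. exp (c k * s k))"
    by (simp add: sum_sign_vectors_eq exp_sum)
  also have "\<dots> = (\<Prod>k\<in>UNIV. \<Sum>s\<in>{-1, 1}. exp (c k * s))"
    by (rule prod_sum_PiE[symmetric]) auto
  also have "\<dots> = (\<Prod>k\<in>UNIV. 2 * cosh (c k))"
    by (intro prod.cong refl) (simp add: cosh_def)
  also have "\<dots> \<le> (\<Prod>k\<in>UNIV. 2 * exp ((c k)\<^sup>2 / 2))"
    by (intro prod_mono) (auto intro: cosh_le_exp_half_square)
  finally show ?thesis
    by (simp add: prod.distrib)
qed

section \<open>Exponential moments and tails of a single entry\<close>

lemma sum_signed_permutations_exp_le:
  fixes a b :: "'n::finite \<Rightarrow> real"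
  assumes a: "(\<Sum>k\<in>UNIV. (a k)\<^sup>2) = 1" and b: "(\<Sum>l\<in>UNIV. (b l)\<^sup>2) = 1"
    and small: "\<And>k l. (t * a k * b l)\<^sup>2 \<le> 1"
  shows "(\<Sum>x\<in>sign_vectors. \<Sum>p\<in>permutation_group. exp (t * (\<Sum>k\<in>UNIV. a k * x $ k * b (p k))))
           \<le> 2 ^ CARD('n) * fact CARD('n) * exp (t\<^sup>2 / real CARD('n))"
proof -
  let ?n = "real CARD('n)"
  let ?g = "\<lambda>k l. exp ((t * a k * b l)\<^sup>2 / 2)"
  have row: "(\<Sum>l\<in>UNIV. ?g k l) / ?n \<le> exp (t\<^sup>2 / ?n * (a k)\<^sup>2)" for k
  proof -
    \<comment> \<open>The exponent lies in [0, 1], where \<open>exp z \<le> 1 + 2 * z\<close>. This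
      bound is linear in \<open>(b l)\<^sup>2\<close>, so the unit norm of \<open>b\<close>
      evaluates its sum over \<open>l\<close>.\<close>
    have "?g k l \<le> 1 + t\<^sup>2 * (a k)\<^sup>2 * (b l)\<^sup>2" for l
    proof -
      define z where "z = (t * a k * b l)\<^sup>2 / 2"
      have z: "0 \<le> z" "z \<le> 1"
        using small[of k l] by (auto simp: z_def)
      have "exp z \<le> 1 + z + z\<^sup>2"
        using z by (rule exp_bound)
      also have "\<dots> \<le> 1 + 2 * z"
        using z mult_left_le_one_le[of z z] by (simp add: power2_eq_square)
      finally show ?thesis
        by (simp add: z_def power_mult_distrib)
    qed
    then have "(\<Sum>l\<in>UNIV. ?g k l) \<le> (\<Sum>l\<in>UNIV. 1 + t\<^sup>2 * (a k)\<^sup>2 * (b l)\<^sup>2)"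
      by (intro sum_mono)
    also have "\<dots> = ?n + t\<^sup>2 * (a k)\<^sup>2"
      using b by (simp add: sum.distrib flip: sum_distrib_left)
    finally have "(\<Sum>l\<in>UNIV. ?g k l) / ?n \<le> 1 + t\<^sup>2 / ?n * (a k)\<^sup>2"
      by (simp add: field_simps)
    also have "\<dots> \<le> exp (t\<^sup>2 / ?n * (a k)\<^sup>2)"
      by (rule exp_ge_add_one_self)
    finally show ?thesis .
  qed
  \<comment> \<open>The signs are summed first, with the permutation fixed.\<close>
  have "(\<Sum>x\<in>sign_vectors. \<Sum>p\<in>permutation_group. exp (t * (\<Sum>k\<in>UNIV. a k * x $ k * b (p k))))
      = (\<Sum>p\<in>permutation_group. \<Sum>x\<in>sign_vectors. exp (\<Sum>k\<in>UNIV. (t * a k * b (p k)) * x $ k))"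
    by (subst sum.swap) (simp add: sum_distrib_left mult_ac)
  also have "\<dots> \<le> (\<Sum>p\<in>permutation_group. 2 ^ CARD('n) * (\<Prod>k\<in>UNIV. ?g k (p k)))"
    by (intro sum_mono sum_sign_vectors_exp_le)
  also have "\<dots> = 2 ^ CARD('n) * (\<Sum>p | p permutes UNIV. \<Prod>k\<in>UNIV. ?g k (p k))"
    by (simp add: sum_distrib_left permutation_group_def)
  \<comment> \<open>Every \<open>?g k l\<close> is nondecreasing in \<open>(b l)\<^sup>2\<close>,
    whatever the signs of \<open>a k\<close> and \<open>b l\<close>, so one key orders all the
    factors.\<close>
  also have "\<dots> \<le> 2 ^ CARD('n) * (fact CARD('n) * (\<Prod>k\<in>UNIV. (\<Sum>l\<in>UNIV. ?g k l) / ?n))"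
    by (intro mult_left_mono sum_permutations_prod_le[where y = "\<lambda>l. (b l)\<^sup>2"])
       (auto simp: power_mult_distrib intro!: mult_left_mono)
  also have "\<dots> \<le> 2 ^ CARD('n) * (fact CARD('n) * (\<Prod>k\<in>UNIV. exp (t\<^sup>2 / ?n * (a k)\<^sup>2)))"
    by (intro mult_left_mono prod_mono conjI row) (auto intro!: sum_nonneg divide_nonneg_nonneg)
  also have "(\<Prod>k\<in>UNIV. exp (t\<^sup>2 / ?n * (a k)\<^sup>2)) = exp (t\<^sup>2 / ?n)"
    by (simp only: a mult_1_right exp_sum[OF finite, symmetric] sum_distrib_left[symmetric])
  finally show ?thesis
    by (simp add: mult_ac)
qed

text \<open>A Chernoff bound in counting form: the prefactor
  \<open>2 ^ CARD('n) * fact CARD('n)\<close> is the number of pairs of a sign vector and a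
  permutation.\<close>

lemma signed_permutations_tail_le:
  fixes a b :: "'n::finite \<Rightarrow> real"
  assumes a: "(\<Sum>k\<in>UNIV. (a k)\<^sup>2) = 1" and b: "(\<Sum>l\<in>UNIV. (b l)\<^sup>2) = 1"
    and small: "\<And>k l. (t * a k * b l)\<^sup>2 \<le> 1" and t: "0 \<le> t"
  shows "(\<Sum>x\<in>sign_vectors. \<Sum>p\<in>permutation_group.
             of_bool (r < \<bar>\<Sum>k\<in>UNIV. a k * x $ k * b (p k)\<bar>) :: real)
           \<le> 2 ^ CARD('n) * fact CARD('n) * (2 * exp (t\<^sup>2 / real CARD('n) - t * r))"
proof -
  let ?X = "\<lambda>(x :: real ^ 'n) p. \<Sum>k\<in>UNIV. a k * x $ k * b (p k)"
  \<comment> \<open>Since \<open>\<bar>u\<bar>\<close> is \<open>u\<close> or \<open>- u\<close>,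
    the sum of both exponentials covers the two tails at once; this is the source of the factor
    2.\<close>
  have markov: "of_bool (r < \<bar>u\<bar>) \<le> exp (- (t * r)) * (exp (t * u) + exp (- t * u))" for u
  proof (cases "r < \<bar>u\<bar>")
    case True
    then have "1 \<le> exp (t * \<bar>u\<bar> - t * r)"
      using t by (simp add: mult_left_mono)
    also have "\<dots> = exp (- (t * r)) * exp (t * \<bar>u\<bar>)"
      by (simp flip: exp_add)
    also have "\<dots> \<le> exp (- (t * r)) * (exp (t * u) + exp (- t * u))"
      by (intro mult_left_mono) (auto simp: abs_if)
    finally show ?thesis using True by simp
  qed simp
  have "(\<Sum>x\<in>sign_vectors. \<Sum>p\<in>permutation_group. of_bool (r < \<bar>?X x p\<bar>) :: real)
      \<le> (\<Sum>x\<in>sign_vectors. \<Sum>p\<in>permutation_group.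
            exp (- (t * r)) * (exp (t * ?X x p) + exp (- t * ?X x p)))"
    by (intro sum_mono markov)
  also have "\<dots> = exp (- (t * r)) *
      ((\<Sum>x\<in>sign_vectors. \<Sum>p\<in>permutation_group. exp (t * ?X x p))
       + (\<Sum>x\<in>sign_vectors. \<Sum>p\<in>permutation_group. exp (- t * ?X x p)))"
    by (simp add: sum.distrib distrib_left flip: sum_distrib_left)
  \<comment> \<open>The condition \<open>small\<close> is even in \<open>t\<close>, so the moment
    bound applies at \<open>- t\<close> as well.\<close>
  also have "\<dots> \<le> exp (- (t * r)) *
      (2 ^ CARD('n) * fact CARD('n) * exp (t\<^sup>2 / real CARD('n))
       + 2 ^ CARD('n) * fact CARD('n) * exp ((- t)\<^sup>2 / real CARD('n)))"
    using small by (intro mult_left_mono add_mono sum_signed_permutations_exp_le a b) auto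
  also have "\<dots> = 2 ^ CARD('n) * fact CARD('n) * (2 * exp (t\<^sup>2 / real CARD('n) - t * r))"
    by (simp add: exp_diff exp_minus divide_inverse)
  finally show ?thesis .
qed

section \<open>Reduction of probabilities to counting for two independent uniform variables\<close>

context
  fixes M :: "'a measure" and X :: "'a \<Rightarrow> 'b" and Y :: "'a \<Rightarrow> 'c" and S T
  assumes M: "prob_space M" and fin: "finite S" "finite T"
    and X: "uniformly_distributed M X S" and Y: "uniformly_distributed M Y T"
    and indep: "independent_rvs M (count_space S) X (count_space T) Y"
begin

interpretation prob_space M by (fact M)

lemma independent_uniform_singletons:
  assumes "x \<in> S" "y \<in> T"
  defines "E \<equiv> X -` {x} \<inter> space M \<inter> (Y -` {y} \<inter> space M)"
  shows "E \<in> sets M" and "prob E = 1 / (real (card S) * real (card T))"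
proof -
  have mX: "X \<in> measurable M (count_space S)" and mY: "Y \<in> measurable M (count_space T)"
    using X Y by (auto simp: uniformly_distributed_def)
  show "E \<in> sets M"
    unfolding E_def using assms(1,2) measurable_sets[OF mX, of "{x}"] measurable_sets[OF mY, of "{y}"]
    by auto
  have "prob (X -` {x} \<inter> space M) = measure (distr M (count_space S) X) {x}"
    using assms(1) mX by (simp add: measure_distr)
  also have "\<dots> = 1 / card S"
    using X fin assms(1) by (simp add: uniformly_distributed_def measure_uniform_count_measure)
  finally have pX: "prob (X -` {x} \<inter> space M) = 1 / card S" .
  have "prob (Y -` {y} \<inter> space M) = measure (distr M (count_space T) Y) {y}"
    using assms(2) mY by (simp add: measure_distr)
  also have "\<dots> = 1 / card T"
    using Y fin assms(2) by (simp add: uniformly_distributed_def measure_uniform_count_measure)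
  finally have pY: "prob (Y -` {y} \<inter> space M) = 1 / card T" .
  have "prob E = prob (X -` {x} \<inter> space M) * prob (Y -` {y} \<inter> space M)"
    unfolding E_def
    by (rule indep_setD[OF indep[unfolded independent_rvs_def, THEN conjunct2, THEN conjunct2]])
       (use assms(1,2) in \<open>auto intro!: in_vimage_algebra\<close>)
  then show "prob E = 1 / (real (card S) * real (card T))"
    by (simp add: pX pY)
qed

text \<open>The event splits into finitely many disjoint events fixing both values, all of equal
  probability.\<close>

lemma independent_uniform_event:
  shows "{\<omega> \<in> space M. Q (X \<omega>) (Y \<omega>)} \<in> sets M" (is "?E \<in> _")
    and "\<P>(\<omega> in M. Q (X \<omega>) (Y \<omega>))
           = (\<Sum>x\<in>S. \<Sum>y\<in>T. of_bool (Q x y)) / (real (card S) * real (card T))"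
proof -
  let ?F = "\<lambda>(x, y). X -` {x} \<inter> space M \<inter> (Y -` {y} \<inter> space M)"
  let ?I = "{z \<in> S \<times> T. Q (fst z) (snd z)}"
  \<comment> \<open>Measurability into \<open>count_space\<close> confines the values to
    \<open>S\<close> and \<open>T\<close> at every point, not just almost surely.\<close>
  have "X \<omega> \<in> S" "Y \<omega> \<in> T" if "\<omega> \<in> space M" for \<omega>
    using X Y that by (auto simp: uniformly_distributed_def dest: measurable_space)
  then have E: "?E = \<Union> (?F ` ?I)"
    by auto
  have F: "?F ` ?I \<subseteq> sets M"
    using independent_uniform_singletons(1) by auto
  show "?E \<in> sets M"
    unfolding E using F fin by (intro sets.finite_UN) auto
  have "prob ?E = (\<Sum>z\<in>?I. prob (?F z))"
    unfolding E using F fin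
    by (intro finite_measure_finite_Union) (auto simp: disjoint_family_on_def)
  also have "\<dots> = (\<Sum>z\<in>?I. 1 / (real (card S) * real (card T)))"
    by (intro sum.cong refl) (auto simp: independent_uniform_singletons(2))
  also have "\<dots> = (\<Sum>z\<in>S \<times> T. of_bool (Q (fst z) (snd z))) / (real (card S) * real (card T))"
    using fin by (simp add: of_bool_def sum.If_cases Int_def)
  also have "(\<Sum>z\<in>S \<times> T. of_bool (Q (fst z) (snd z))) = (\<Sum>x\<in>S. \<Sum>y\<in>T. of_bool (Q x y) :: real)"
    by (simp add: sum.cartesian_product case_prod_beta)
  finally show "prob ?E = (\<Sum>x\<in>S. \<Sum>y\<in>T. of_bool (Q x y)) / (real (card S) * real (card T))" .
qed

end

section \<open>Entries of orthogonal matrices and of the product\<close>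

lemma max_entry_le_iff:
  fixes A :: "real ^ 'n::finite ^ 'm::finite"
  shows "max_entry A \<le> c \<longleftrightarrow> (\<forall>i j. \<bar>A $ i $ j\<bar> \<le> c)"
proof -
  have eq: "{\<bar>A $ i $ j\<bar> | i j. True} = range (\<lambda>(i, j). \<bar>A $ i $ j\<bar>)"
    by auto
  show ?thesis
    unfolding max_entry_def eq by (subst Max_le_iff) auto
qed

lemma orthogonal_matrix_row_norm:
  fixes A :: "real ^ 'n::finite ^ 'n"
  assumes "orthogonal_matrix A"
  shows "(\<Sum>k\<in>UNIV. (A $ i $ k)\<^sup>2) = 1"
proof -
  have "(A ** transpose A) $ i $ i = (mat 1 :: real ^ 'n ^ 'n) $ i $ i"
    using assms by (simp add: orthogonal_matrix_def)
  then show ?thesis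
    by (simp add: matrix_matrix_mult_def Finite_Cartesian_Product.transpose_def mat_def power2_eq_square)
qed

lemma orthogonal_matrix_column_norm:
  fixes A :: "real ^ 'n::finite ^ 'n"
  assumes "orthogonal_matrix A"
  shows "(\<Sum>k\<in>UNIV. (A $ k $ j)\<^sup>2) = 1"
proof -
  have "orthogonal_matrix (Finite_Cartesian_Product.transpose A)"
    using assms by (simp add: orthogonal_matrix_transpose)
  from orthogonal_matrix_row_norm[OF this, of j] show ?thesis
    by (simp add: Finite_Cartesian_Product.transpose_def)
qed

text \<open>The diagonal factor scales the columns of \<open>A\<close> and the permutation factor
  reorders the rows of \<open>B\<close>, so grouping the product this way leaves a single
  sum.\<close>

lemma diag_perm_product_entry:
  fixes A B :: "real ^ 'n::finite ^ 'n"
  shows "(A ** diag_matrix x ** perm_matrix p ** B) $ i $ j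
           = (\<Sum>k\<in>UNIV. A $ i $ k * x $ k * B $ p k $ j)"
proof -
  have AD: "(A ** diag_matrix x) $ i $ k = A $ i $ k * x $ k" for k
    by (simp add: matrix_matrix_mult_def diag_matrix_def if_distrib cong: if_cong)
  have PB: "(perm_matrix p ** B) $ k $ j = B $ p k $ j" for k
    by (simp add: matrix_matrix_mult_def perm_matrix_def if_distribR if_distrib[of "\<lambda>t. t * _"]
        cong: if_cong)
  have "(A ** diag_matrix x ** perm_matrix p ** B) $ i $ j
      = (A ** diag_matrix x ** (perm_matrix p ** B)) $ i $ j"
    by (simp add: matrix_mul_assoc)
  also have "\<dots> = (\<Sum>k\<in>UNIV. (A ** diag_matrix x) $ i $ k * (perm_matrix p ** B) $ k $ j)"
    by (simp add: matrix_matrix_mult_def)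
  finally show ?thesis
    by (simp add: AD PB)
qed

section \<open>Choice of parameters and union bound\<close>

theorem corollary1p4:
  fixes A B :: "real ^ 'n::finite ^ 'n"
    and M :: "'a measure"
    and \<xi> :: "'a \<Rightarrow> real ^ 'n"
    and \<pi> :: "'a \<Rightarrow> 'n \<Rightarrow> 'n"
    and U :: "'a \<Rightarrow> real ^ 'n ^ 'n"
    and \<eta> d :: real
  defines "d \<equiv> real CARD('n)"
    and "U \<equiv> (\<lambda>\<omega>. A ** diag_matrix (\<xi> \<omega>) ** perm_matrix (\<pi> \<omega>) ** B)"
  assumes "orthogonal_matrix A" and "orthogonal_matrix B"
    and "prob_space M"
    and "uniformly_distributed M \<xi> sign_vectors"
    and "uniformly_distributed M \<pi> permutation_group"
    and "independent_rvs M (count_space sign_vectors) \<xi> (count_space permutation_group) \<pi>"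
    and "0 < \<eta>" and "\<eta> < 1 / 2"
    and "max_entry A * max_entry B \<le> 1 / sqrt (d * ln (d / \<eta>))"
  shows "\<P>(\<omega> in M. max_entry (U \<omega>) \<le> 4 * (sqrt (ln (d / \<eta>)) / sqrt d)) \<ge> 1 - \<eta>"
proof -
  interpret prob_space M by fact
  define L where "L = ln (d / \<eta>)"
  define r where "r = 4 * (sqrt L / sqrt d)"
  \<comment> \<open>With this \<open>t\<close> the hypothesis on \<open>A\<close> and
    \<open>B\<close> is exactly a bound by \<open>1 / t\<close>, and the tail exponent
    \<open>t\<^sup>2 / d - t * r\<close> becomes \<open>L - 4 * L\<close>.\<close>
  define t where "t = sqrt (d * L)"
  have d: "1 \<le> d"
    unfolding d_def by (simp add: Suc_le_eq)
  have L: "0 < L"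
    using d \<open>0 < \<eta>\<close> \<open>\<eta> < 1 / 2\<close> by (simp add: L_def field_simps)
  have t: "0 < t" "t\<^sup>2 / d = L" "t * r = 4 * L"
    using d L by (auto simp: t_def r_def real_sqrt_mult field_simps)
  have small: "(t * A $ i $ k * B $ l $ j)\<^sup>2 \<le> 1" for i j k l
  proof -
    have entry: "\<bar>A $ i $ k\<bar> \<le> max_entry A" "\<bar>B $ l $ j\<bar> \<le> max_entry B"
      using max_entry_le_iff[of A "max_entry A"] max_entry_le_iff[of B "max_entry B"] by auto
    then have "\<bar>A $ i $ k\<bar> * \<bar>B $ l $ j\<bar> \<le> max_entry A * max_entry B"
      by (intro mult_mono) auto
    also have "\<dots> \<le> 1 / t"
      using assms(11) by (simp add: t_def L_def)
    finally have "\<bar>t * A $ i $ k * B $ l $ j\<bar> \<le> 1"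
      using t(1) by (simp add: abs_mult field_simps)
    then show ?thesis
      by (simp add: abs_square_le_1)
  qed
  let ?bad = "\<lambda>i j. {\<omega> \<in> space M. r < \<bar>U \<omega> $ i $ j\<bar>}"
  note event = independent_uniform_event[OF \<open>prob_space M\<close> finite_sign_vectors _ assms(6-8)]
  have finP: "finite (permutation_group :: ('n \<Rightarrow> 'n) set)"
    by (rule finite)
  have bad_sets: "?bad i j \<in> sets M" for i j
    unfolding U_def using event(1)[OF finP] .
  have bad_prob: "prob (?bad i j) \<le> 2 * exp (- 3 * L)" for i j
  proof -
    have "prob (?bad i j) = (\<Sum>x\<in>sign_vectors. \<Sum>p\<in>permutation_group.
          of_bool (r < \<bar>\<Sum>k\<in>UNIV. A $ i $ k * x $ k * B $ p k $ j\<bar>)) / (2 ^ CARD('n) * fact CARD('n))"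
      unfolding U_def diag_perm_product_entry
      by (subst event(2)[OF finP]) (simp add: card_sign_vectors card_permutation_group)
    also have "\<dots> \<le> 2 ^ CARD('n) * fact CARD('n) * (2 * exp (t\<^sup>2 / real CARD('n) - t * r))
          / (2 ^ CARD('n) * fact CARD('n))"
      using orthogonal_matrix_row_norm[OF assms(3)] orthogonal_matrix_column_norm[OF assms(4)] small t
      by (intro divide_right_mono signed_permutations_tail_le) auto
    also have "\<dots> = 2 * exp (- 3 * L)"
      using t by (simp add: d_def)
    finally show ?thesis .
  qed
  have compl: "{\<omega> \<in> space M. max_entry (U \<omega>) \<le> r} = space M - (\<Union>(i, j)\<in>UNIV. ?bad i j)"
    by (auto simp: max_entry_le_iff) (meson not_less)+
  have "prob (\<Union>(i, j)\<in>UNIV. ?bad i j) \<le> (\<Sum>(i, j)\<in>UNIV. prob (?bad i j))"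
    using bad_sets finite_measure_subadditive_finite[of UNIV "\<lambda>(i, j). ?bad i j"]
    by (auto simp: case_prod_beta)
  also have "\<dots> \<le> (\<Sum>(i :: 'n, j :: 'n)\<in>UNIV. 2 * exp (- 3 * L))"
    using bad_prob by (intro sum_mono) auto
  also have "\<dots> = d\<^sup>2 * (2 * exp (- 3 * L))"
    by (simp add: d_def power2_eq_square card_prod flip: UNIV_Times_UNIV)
  \<comment> \<open>The cube absorbs the \<open>d\<^sup>2\<close> entries and leaves a spare factor
    \<open>1 / d\<close>.\<close>
  also have "exp (- 3 * L) = (\<eta> / d) ^ 3"
  proof -
    have "exp (- L) = \<eta> / d"
      using d \<open>0 < \<eta>\<close> by (simp add: L_def exp_minus)
    then show ?thesis
      using exp_of_nat_mult[of 3 "- L"] by simp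
  qed
  also have "d\<^sup>2 * (2 * (\<eta> / d) ^ 3) = 2 * \<eta> ^ 2 / d * \<eta>"
    using d by (simp add: field_simps power2_eq_square power3_eq_cube)
  \<comment> \<open>Here \<open>\<eta> < 1 / 2\<close> and \<open>1 \<le> d\<close> keep the factor
    \<open>2 * \<eta> ^ 2 / d\<close> below 1.\<close>
  also have "\<dots> \<le> \<eta>"
  proof -
    have "\<eta>\<^sup>2 \<le> (1 / 2)\<^sup>2"
      using \<open>0 < \<eta>\<close> \<open>\<eta> < 1 / 2\<close> by (intro power_mono) auto
    then have "2 * \<eta> ^ 2 / d \<le> 1"
      using d by (simp add: power2_eq_square field_simps)
    then show ?thesis
      using \<open>0 < \<eta>\<close> by (intro mult_left_le_one_le) (use d in auto)
  qed
  finally have "1 - \<eta> \<le> 1 - prob (\<Union>(i, j)\<in>UNIV. ?bad i j)"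
    by simp
  also have "\<dots> = prob {\<omega> \<in> space M. max_entry (U \<omega>) \<le> r}"
    unfolding compl using bad_sets by (intro prob_compl[symmetric] sets.finite_UN) auto
  finally show ?thesis
    by (simp add: r_def L_def)
qed

end
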